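(* Alice wins every canonical ESD labeling game on a star $S_n=K_{1,n-1}$, regardless of how the players play.
   Context: For a graph $G=(V,E)$ and $l\in\mathbb N$, a vertex labeling $\phi:V\to\{1,\dots,l\}$ is an edge-sum distinguishing (ESD) labeling if $\phi$ is injective and the edge-weights $w_\phi(uv)=\phi(u)+\phi(v)$ are pairwise distinct over all edges $uv\in E$. ESD labeling game on $G$ with label set $L=\{1,\dots,l\}$: Alice and Bob alternate moves, Alice starting. In each move the player chooses a not-yet-labeled vertex and assigns to it a label from $L$ not used before; the move is legal if the edge-weights of edges with both endpoints labeled remain pairwise distinct. The game ends when no legal move is possible or an ESD labeling of $G$ is created; Alice wins if an ESD labeling is created, otherwise Bob wins. The game is canonical if $|L|=|V(G)|$. *)

theory Defs
  imports Main
begin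

definition simple_graph :: "'a set \<Rightarrow> 'a set set \<Rightarrow> bool" where
  "simple_graph V E \<longleftrightarrow> finite V \<and> (\<forall>e\<in>E. e \<subseteq> V \<and> card e = 2)"

text \<open>The vertex set is arbitrary, so this describes \<open>K\<^bsub>1,n-1\<^esub>\<close> up to isomorphism;
  \<open>n \<ge> 1\<close> is forced by the existence of the centre \<open>c\<close>.\<close>

definition is_star :: "nat \<Rightarrow> 'a set \<Rightarrow> 'a set set \<Rightarrow> bool" where
  "is_star n V E \<longleftrightarrow> finite V \<and> card V = n \<and> (\<exists>c\<in>V. E = {{c, v} | v. v \<in> V - {c}})"

lemma is_star_simple_graph: "is_star n V E \<Longrightarrow> simple_graph V E"
  by (auto simp: is_star_def simple_graph_def card_insert_if)

definition edge_weight :: "('a \<Rightarrow> nat) \<Rightarrow> 'a set \<Rightarrow> nat" where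
  "edge_weight \<phi> e = (\<Sum>u\<in>e. \<phi> u)"

lemma edge_weight_edge: "u \<noteq> v \<Longrightarrow> edge_weight \<phi> {u, v} = \<phi> u + \<phi> v"
  by (simp add: edge_weight_def)

definition esd_labeling :: "'a set \<Rightarrow> 'a set set \<Rightarrow> nat \<Rightarrow> ('a \<Rightarrow> nat) \<Rightarrow> bool" where
  "esd_labeling V E l \<phi> \<longleftrightarrow>
     \<phi> ` V \<subseteq> {1..l} \<and> inj_on \<phi> V \<and> inj_on (edge_weight \<phi>) E"

datatype player = Alice | Bob

fun opponent :: "player \<Rightarrow> player" where
  "opponent Alice = Bob"
| "opponent Bob = Alice"

text \<open>The state of the board is a partial labeling \<open>f\<close>; \<open>dom f\<close> is the set of vertices
  labeled so far and \<open>ran f\<close> the set of labels used so far.\<close>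

definition partial_weights_distinct :: "'a set set \<Rightarrow> ('a \<rightharpoonup> nat) \<Rightarrow> bool" where
  "partial_weights_distinct E f \<longleftrightarrow>
     inj_on (edge_weight (the \<circ> f)) {e \<in> E. e \<subseteq> dom f}"

definition legal_move ::
  "'a set \<Rightarrow> 'a set set \<Rightarrow> nat \<Rightarrow> ('a \<rightharpoonup> nat) \<Rightarrow> 'a \<Rightarrow> nat \<Rightarrow> bool" where
  "legal_move V E l f v a \<longleftrightarrow>
     v \<in> V - dom f \<and> a \<in> {1..l} - ran f \<and> partial_weights_distinct E (f(v \<mapsto> a))"

definition esd_created :: "'a set \<Rightarrow> 'a set set \<Rightarrow> nat \<Rightarrow> ('a \<rightharpoonup> nat) \<Rightarrow> bool" where
  "esd_created V E l f \<longleftrightarrow> dom f = V \<and> esd_labeling V E l (the \<circ> f)"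

definition game_over :: "'a set \<Rightarrow> 'a set set \<Rightarrow> nat \<Rightarrow> ('a \<rightharpoonup> nat) \<Rightarrow> bool" where
  "game_over V E l f \<longleftrightarrow> esd_created V E l f \<or> \<not> (\<exists>v a. legal_move V E l f v a)"

definition winner :: "'a set \<Rightarrow> 'a set set \<Rightarrow> nat \<Rightarrow> ('a \<rightharpoonup> nat) \<Rightarrow> player" where
  "winner V E l f = (if esd_created V E l f then Alice else Bob)"

text \<open>\<open>play V E l ms p f\<close>: starting from the unlabeled graph with Alice to move, the
  sequence of moves \<open>ms\<close> can be played; it leads to the partial labeling \<open>f\<close> with
  player \<open>p\<close> to move next.\<close>

inductive play ::
  "'a set \<Rightarrow> 'a set set \<Rightarrow> nat \<Rightarrow> ('a \<times> nat) list \<Rightarrow> player \<Rightarrow> ('a \<rightharpoonup> nat) \<Rightarrow> bool"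
  for V :: "'a set" and E :: "'a set set" and l :: nat where
  start: "play V E l [] Alice Map.empty"
| move: "play V E l (ms @ [(v, a)]) (opponent p) (f(v \<mapsto> a))"
    if "play V E l ms p f" and "\<not> game_over V E l f" and "legal_move V E l f v a"

definition complete_play ::
  "'a set \<Rightarrow> 'a set set \<Rightarrow> nat \<Rightarrow> ('a \<times> nat) list \<Rightarrow> player \<Rightarrow> ('a \<rightharpoonup> nat) \<Rightarrow> bool" where
  "complete_play V E l ms p f \<longleftrightarrow> play V E l ms p f \<and> game_over V E l f"

text \<open>A statement about all complete plays covers every way of playing the game: there is no
  infinite play, and every play can be continued to a complete one.\<close>

lemma play_length:
  assumes "play V E l ms p f" "finite V"
  shows "dom f \<subseteq> V \<and> length ms = card (dom f)"
  using assms
proof (induction rule: play.induct)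
  case start
  then show ?case by simp
next
  case (move ms p f v a)
  then have "finite (dom f)" by (auto intro: finite_subset)
  moreover have "dom (f(v \<mapsto> a)) = insert v (dom f)" by simp
  moreover have "v \<in> V - dom f" using move by (simp add: legal_move_def)
  ultimately show ?case using move.IH move.prems
    by (simp only:) (simp add: card_insert_if)
qed

lemma play_length_le: "play V E l ms p f \<Longrightarrow> finite V \<Longrightarrow> length ms \<le> card V"
  using play_length card_mono by metis

lemma play_extends_to_complete:
  assumes "play V E l ms p f" "finite V"
  shows "\<exists>ms' p' f'. complete_play V E l (ms @ ms') p' f'"
  using assms
proof (induction "card V - length ms" arbitrary: ms p f rule: less_induct)
  case less
  show ?case
  proof (cases "game_over V E l f")
    case True
    with less.prems have "complete_play V E l (ms @ []) p f"
      by (simp add: complete_play_def)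
    then show ?thesis by blast
  next
    case False
    then obtain v a where "legal_move V E l f v a" by (auto simp: game_over_def)
    with less.prems False have next_play:
      "play V E l (ms @ [(v, a)]) (opponent p) (f(v \<mapsto> a))"
      by (blast intro: play.move)
    from play_length_le[OF this less.prems(2)]
    have "card V - length (ms @ [(v, a)]) < card V - length ms" by simp
    from less.hyps[OF this next_play less.prems(2)] show ?thesis
      by (metis append.assoc)
  qed
qed

end

theory Submission
  imports Defs
begin

text \<open>All edges of a star share the centre, so distinct labels force distinct weights and
  every placement of an unused label is legal. With as many labels as vertices, the play
  cannot stop before all vertices are labeled.\<close>

text \<open>Cancelling the label of the centre turns equal weights into equal leaf labels. Keeping
  \<open>A\<close> general covers both uses: the domain of a partial labeling after a move, and all
  of \<open>V\<close> at the end.\<close>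

lemma star_weights_inj_on:
  assumes "is_star n V E" "inj_on \<phi> A"
  shows "inj_on (edge_weight \<phi>) {e \<in> E. e \<subseteq> A}"
proof (rule inj_onI)
  fix e e' assume e: "e \<in> {e \<in> E. e \<subseteq> A}" and e': "e' \<in> {e \<in> E. e \<subseteq> A}"
    and eq: "edge_weight \<phi> e = edge_weight \<phi> e'"
  from assms(1) obtain c where E: "E = {{c, v} | v. v \<in> V - {c}}"
    by (auto simp: is_star_def)
  from e E obtain v where v: "e = {c, v}" "c \<noteq> v" "v \<in> A" by auto
  from e' E obtain w where w: "e' = {c, w}" "c \<noteq> w" "w \<in> A" by auto
  have "\<phi> v = \<phi> w" using eq v w by (simp add: edge_weight_edge)
  then show "e = e'" using v w assms(2) by (auto dest: inj_onD)
qed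

lemma inj_on_the_comp:
  assumes "inj_on f (dom f)"
  shows "inj_on (the \<circ> f) (dom f)"
  using assms by (auto simp: inj_on_def dom_def)

lemma inj_on_dom_map_upd:
  assumes "inj_on f (dom f)" "a \<notin> ran f"
  shows "inj_on (f(v \<mapsto> a)) (dom (f(v \<mapsto> a)))"
  using assms by (auto simp: inj_on_def ran_def)

lemma play_partial_labeling:
  assumes "play V E l ms p f"
  shows "inj_on f (dom f) \<and> ran f \<subseteq> {1..l}"
  using assms
proof (induction rule: play.induct)
  case start
  then show ?case by simp
next
  case (move ms p f v a)
  then have "a \<in> {1..l}" "a \<notin> ran f" "f v = None"
    by (auto simp: legal_move_def)
  with move.IH show ?case
    using inj_on_dom_map_upd by (metis insert_subset ran_map_upd)
qed

lemma star_legal_move: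
  assumes "is_star n V E" "inj_on f (dom f)" "v \<in> V - dom f" "a \<in> {1..l} - ran f"
  shows "legal_move V E l f v a"
  using assms unfolding legal_move_def partial_weights_distinct_def
  by (intro conjI star_weights_inj_on inj_on_the_comp inj_on_dom_map_upd) auto

lemma star_esd_created:
  assumes "is_star n V E" "inj_on f (dom f)" "ran f \<subseteq> {1..l}" "dom f = V"
  shows "esd_created V E l f"
proof -
  have inj: "inj_on (the \<circ> f) V"
    using inj_on_the_comp[OF assms(2)] assms(4) by simp
  \<comment> \<open>With every vertex labeled, the restriction to fully labeled edges becomes
    vacuous.\<close>
  have "{e \<in> E. e \<subseteq> V} = E"
    using assms(1) by (auto simp: is_star_def)
  then have "inj_on (edge_weight (the \<circ> f)) E"
    using star_weights_inj_on[OF assms(1) inj] by simp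
  moreover have "(the \<circ> f) ` V \<subseteq> {1..l}"
    using assms(3,4) by (force simp: ran_def)
  ultimately show ?thesis
    using inj assms(4) by (simp add: esd_created_def esd_labeling_def)
qed

theorem theorem11:
  fixes V :: "'a set" and E :: "'a set set" and n l :: nat
    and ms :: "('a \<times> nat) list" and p :: player and f :: "'a \<rightharpoonup> nat"
  assumes star: "is_star n V E"
    and canonical: "l = card V"
    and complete: "complete_play V E l ms p f"
  shows "winner V E l f = Alice"
proof -
  have "finite V" using star by (simp add: is_star_def)
  have "play V E l ms p f" and over: "game_over V E l f"
    using complete by (auto simp: complete_play_def)
  then have inj: "inj_on f (dom f)" and ran: "ran f \<subseteq> {1..l}" and dom: "dom f \<subseteq> V"
    using play_partial_labeling play_length \<open>finite V\<close> by blast+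
  have "esd_created V E l f"
  proof (cases "dom f = V")
    case True
    then show ?thesis using star_esd_created[OF star inj ran] by simp
  next
    case False
    then obtain v where v: "v \<in> V - dom f" using dom by auto
    have fin: "finite (dom f)" using dom \<open>finite V\<close> by (rule finite_subset)
    have "ran f = (the \<circ> f) ` dom f" by (force simp: ran_def)
    then have "card (ran f) \<le> card (dom f)" by (simp add: card_image_le fin)
    \<comment> \<open>Canonicity enters here: an unlabeled vertex remains, so fewer than
      \<open>card V = l\<close> vertices are labeled and some label is still free.\<close>
    also have "\<dots> < card {1..l}"
      using psubset_card_mono[OF \<open>finite V\<close>] dom False canonical by simp
    finally have "ran f \<noteq> {1..l}" by auto
    then obtain a where "a \<in> {1..l} - ran f" using ran by blast
    then have "legal_move V E l f v a" by (rule star_legal_move[OF star inj v])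
    \<comment> \<open>The legal move refutes the second disjunct of \<open>game_over\<close>,
      leaving \<open>esd_created\<close>. The case is in fact contradictory, since
      \<open>esd_created\<close> would force \<open>dom f = V\<close>.\<close>
    then show ?thesis using over by (auto simp: game_over_def)
  qed
  then show ?thesis by (simp add: winner_def)
qed

end
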